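(* Let $\mathbb C$ be a finitely cocomplete homological category and let $n:N\to E$ be a proper subobject in $\mathbb C$. Then there is an action $c^{N,E}:(N|E)\to N$ of $E$ on $N$ such that $n\,c^{N,E}=c_2^E\,(n|1)$ (called the conjugation action of $E$ on $N$). It is natural with respect to pair maps $(E,N)\to(E',N')$, i.e. with respect to maps $f:E\to E'$ in $\mathbb C$ such that $f(N)\subset N'$, for a given proper subobject $N'$ of $E'$: if $f_N:N\to N'$ denotes the restriction of $f$, then $f_N\,c^{N,E}=c^{N',E'}\,(f_N|f)$.
   Context: Homological means pointed, finitely complete, regular and protomodular. A subobject is proper if it is the kernel of some map. For objects $A,G$: $i_A,i_G$ are the injections into $A+G$; $(A|G)$ is the kernel of the canonical map $b:A+G\to A\times G$, with inclusion $\iota:(A|G)\to A+G$; for $a:A\to A'$, $g:G\to G'$, $(a|g):(A|G)\to(A'|G')$ is the map with $\iota(a|g)=(a+g)\iota$. A map $\psi:(A|G)\to A$ is an action of $G$ on $A$ if the composite $q_\psi i_A$ is a monomorphism, where $q_\psi:A+G\to Q_\psi$ is the coequalizer of $\iota$ and $i_A\psi$. For an object $E$, $c_2^E=\nabla_E\,\iota_{E,E}:(E|E)\to E$, where $\nabla_E=\langle 1,1\rangle:E+E\to E$ is the codiagonal. *)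

theory Defs
  imports Main
begin

section \<open>Categories\<close>

record ('o, 'a) category =
  Obj :: "'o set"
  Arr :: "'a set"
  Dom :: "'a \<Rightarrow> 'o"
  Cod :: "'a \<Rightarrow> 'o"
  Ident :: "'o \<Rightarrow> 'a"
  Comp :: "'a \<Rightarrow> 'a \<Rightarrow> 'a" (infixr "\<cdot>\<index>" 70)

text \<open>Composition is written in applicative order; \<open>g \<cdot> f\<close> is only meaningful if \<open>Cod f = Dom g\<close>.\<close>

definition hom :: "('o, 'a) category \<Rightarrow> 'o \<Rightarrow> 'o \<Rightarrow> 'a set" where
  "hom C A B = {f \<in> Arr C. Dom C f = A \<and> Cod C f = B}"

locale category =
  fixes C :: "('o, 'a) category" (structure)
  assumes Dom_in_Obj: "f \<in> Arr C \<Longrightarrow> Dom C f \<in> Obj C"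
    and Cod_in_Obj: "f \<in> Arr C \<Longrightarrow> Cod C f \<in> Obj C"
    and Ident_in_hom: "A \<in> Obj C \<Longrightarrow> Ident C A \<in> hom C A A"
    and Comp_in_hom: "f \<in> hom C X Y \<Longrightarrow> g \<in> hom C Y Z \<Longrightarrow> g \<cdot> f \<in> hom C X Z"
    and Comp_Ident_right: "f \<in> hom C X Y \<Longrightarrow> f \<cdot> Ident C X = f"
    and Comp_Ident_left: "f \<in> hom C X Y \<Longrightarrow> Ident C Y \<cdot> f = f"
    and Comp_assoc: "f \<in> hom C W X \<Longrightarrow> g \<in> hom C X Y \<Longrightarrow> h \<in> hom C Y Z
      \<Longrightarrow> (h \<cdot> g) \<cdot> f = h \<cdot> (g \<cdot> f)"

definition monic :: "('o, 'a) category \<Rightarrow> 'a \<Rightarrow> bool" where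
  "monic C m \<longleftrightarrow> m \<in> Arr C \<and>
     (\<forall>X. \<forall>u \<in> hom C X (Dom C m). \<forall>v \<in> hom C X (Dom C m).
        m \<cdot>\<^bsub>C\<^esub> u = m \<cdot>\<^bsub>C\<^esub> v \<longrightarrow> u = v)"

definition isomorphism :: "('o, 'a) category \<Rightarrow> 'a \<Rightarrow> bool" where
  "isomorphism C f \<longleftrightarrow> f \<in> Arr C \<and>
     (\<exists>g \<in> hom C (Cod C f) (Dom C f).
        g \<cdot>\<^bsub>C\<^esub> f = Ident C (Dom C f) \<and> f \<cdot>\<^bsub>C\<^esub> g = Ident C (Cod C f))"


section \<open>Finite limits and colimits\<close>

definition is_functor ::
  "('j, 'b) category \<Rightarrow> ('o, 'a) category \<Rightarrow> ('j \<Rightarrow> 'o) \<Rightarrow> ('b \<Rightarrow> 'a) \<Rightarrow> bool" where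
  "is_functor J C Fo Fa \<longleftrightarrow>
     (\<forall>j \<in> Obj J. Fo j \<in> Obj C) \<and>
     (\<forall>u \<in> Arr J. Fa u \<in> hom C (Fo (Dom J u)) (Fo (Cod J u))) \<and>
     (\<forall>j \<in> Obj J. Fa (Ident J j) = Ident C (Fo j)) \<and>
     (\<forall>u \<in> Arr J. \<forall>v \<in> Arr J. Cod J u = Dom J v \<longrightarrow>
        Fa (v \<cdot>\<^bsub>J\<^esub> u) = Fa v \<cdot>\<^bsub>C\<^esub> Fa u)"

definition cone ::
  "('j, 'b) category \<Rightarrow> ('o, 'a) category \<Rightarrow> ('j \<Rightarrow> 'o) \<Rightarrow> ('b \<Rightarrow> 'a)
    \<Rightarrow> 'o \<Rightarrow> ('j \<Rightarrow> 'a) \<Rightarrow> bool" where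
  "cone J C Fo Fa L p \<longleftrightarrow> L \<in> Obj C \<and>
     (\<forall>j \<in> Obj J. p j \<in> hom C L (Fo j)) \<and>
     (\<forall>u \<in> Arr J. Fa u \<cdot>\<^bsub>C\<^esub> p (Dom J u) = p (Cod J u))"

definition limit_cone ::
  "('j, 'b) category \<Rightarrow> ('o, 'a) category \<Rightarrow> ('j \<Rightarrow> 'o) \<Rightarrow> ('b \<Rightarrow> 'a)
    \<Rightarrow> 'o \<Rightarrow> ('j \<Rightarrow> 'a) \<Rightarrow> bool" where
  "limit_cone J C Fo Fa L p \<longleftrightarrow> cone J C Fo Fa L p \<and>
     (\<forall>M q. cone J C Fo Fa M q \<longrightarrow>
        (\<exists>!u. u \<in> hom C M L \<and> (\<forall>j \<in> Obj J. p j \<cdot>\<^bsub>C\<^esub> u = q j)))"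

definition cocone ::
  "('j, 'b) category \<Rightarrow> ('o, 'a) category \<Rightarrow> ('j \<Rightarrow> 'o) \<Rightarrow> ('b \<Rightarrow> 'a)
    \<Rightarrow> 'o \<Rightarrow> ('j \<Rightarrow> 'a) \<Rightarrow> bool" where
  "cocone J C Fo Fa L i \<longleftrightarrow> L \<in> Obj C \<and>
     (\<forall>j \<in> Obj J. i j \<in> hom C (Fo j) L) \<and>
     (\<forall>u \<in> Arr J. i (Cod J u) \<cdot>\<^bsub>C\<^esub> Fa u = i (Dom J u))"

definition colimit_cocone ::
  "('j, 'b) category \<Rightarrow> ('o, 'a) category \<Rightarrow> ('j \<Rightarrow> 'o) \<Rightarrow> ('b \<Rightarrow> 'a)
    \<Rightarrow> 'o \<Rightarrow> ('j \<Rightarrow> 'a) \<Rightarrow> bool" where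
  "colimit_cocone J C Fo Fa L i \<longleftrightarrow> cocone J C Fo Fa L i \<and>
     (\<forall>M k. cocone J C Fo Fa M k \<longrightarrow>
        (\<exists>!u. u \<in> hom C L M \<and> (\<forall>j \<in> Obj J. u \<cdot>\<^bsub>C\<^esub> i j = k j)))"

text \<open>Every finite category is isomorphic to one whose objects and arrows are natural numbers,
  so it suffices to let the shapes range over the latter.\<close>

definition finitely_complete :: "('o, 'a) category \<Rightarrow> bool" where
  "finitely_complete C \<longleftrightarrow>
     (\<forall>(J :: (nat, nat) category) Fo Fa.
        category J \<and> finite (Obj J) \<and> finite (Arr J) \<and> is_functor J C Fo Fa \<longrightarrow>
        (\<exists>L p. limit_cone J C Fo Fa L p))"

definition finitely_cocomplete :: "('o, 'a) category \<Rightarrow> bool" where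
  "finitely_cocomplete C \<longleftrightarrow>
     (\<forall>(J :: (nat, nat) category) Fo Fa.
        category J \<and> finite (Obj J) \<and> finite (Arr J) \<and> is_functor J C Fo Fa \<longrightarrow>
        (\<exists>L i. colimit_cocone J C Fo Fa L i))"


section \<open>Particular limits and colimits\<close>

definition is_product :: "('o, 'a) category \<Rightarrow> 'o \<Rightarrow> 'o \<Rightarrow> 'a \<Rightarrow> 'a \<Rightarrow> bool" where
  "is_product C A B p q \<longleftrightarrow> p \<in> hom C (Dom C p) A \<and> q \<in> hom C (Dom C p) B \<and>
     (\<forall>X. \<forall>f \<in> hom C X A. \<forall>g \<in> hom C X B.
        \<exists>!u. u \<in> hom C X (Dom C p) \<and> p \<cdot>\<^bsub>C\<^esub> u = f \<and> q \<cdot>\<^bsub>C\<^esub> u = g)"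

definition is_coproduct :: "('o, 'a) category \<Rightarrow> 'o \<Rightarrow> 'o \<Rightarrow> 'a \<Rightarrow> 'a \<Rightarrow> bool" where
  "is_coproduct C A B i j \<longleftrightarrow> i \<in> hom C A (Cod C i) \<and> j \<in> hom C B (Cod C i) \<and>
     (\<forall>X. \<forall>f \<in> hom C A X. \<forall>g \<in> hom C B X.
        \<exists>!u. u \<in> hom C (Cod C i) X \<and> u \<cdot>\<^bsub>C\<^esub> i = f \<and> u \<cdot>\<^bsub>C\<^esub> j = g)"

text \<open>\<open>f \<cdot> p = g \<cdot> q\<close>: thus \<open>q\<close> is the pullback of \<open>f\<close> along \<open>g\<close>.\<close>

definition is_pullback :: "('o, 'a) category \<Rightarrow> 'a \<Rightarrow> 'a \<Rightarrow> 'a \<Rightarrow> 'a \<Rightarrow> bool" where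
  "is_pullback C f g p q \<longleftrightarrow> f \<in> Arr C \<and> g \<in> Arr C \<and> Cod C f = Cod C g \<and>
     p \<in> hom C (Dom C p) (Dom C f) \<and> q \<in> hom C (Dom C p) (Dom C g) \<and>
     f \<cdot>\<^bsub>C\<^esub> p = g \<cdot>\<^bsub>C\<^esub> q \<and>
     (\<forall>X. \<forall>x \<in> hom C X (Dom C f). \<forall>y \<in> hom C X (Dom C g).
        f \<cdot>\<^bsub>C\<^esub> x = g \<cdot>\<^bsub>C\<^esub> y \<longrightarrow>
        (\<exists>!u. u \<in> hom C X (Dom C p) \<and> p \<cdot>\<^bsub>C\<^esub> u = x \<and> q \<cdot>\<^bsub>C\<^esub> u = y))"

definition is_coequalizer :: "('o, 'a) category \<Rightarrow> 'a \<Rightarrow> 'a \<Rightarrow> 'a \<Rightarrow> bool" where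
  "is_coequalizer C f g q \<longleftrightarrow> f \<in> Arr C \<and> g \<in> hom C (Dom C f) (Cod C f) \<and>
     q \<in> hom C (Cod C f) (Cod C q) \<and> q \<cdot>\<^bsub>C\<^esub> f = q \<cdot>\<^bsub>C\<^esub> g \<and>
     (\<forall>X. \<forall>h \<in> hom C (Cod C f) X. h \<cdot>\<^bsub>C\<^esub> f = h \<cdot>\<^bsub>C\<^esub> g \<longrightarrow>
        (\<exists>!u. u \<in> hom C (Cod C q) X \<and> u \<cdot>\<^bsub>C\<^esub> q = h))"


section \<open>Homological categories\<close>

definition zero_object :: "('o, 'a) category \<Rightarrow> 'o \<Rightarrow> bool" where
  "zero_object C Z \<longleftrightarrow> Z \<in> Obj C \<and>
     (\<forall>X \<in> Obj C. (\<exists>!f. f \<in> hom C X Z) \<and> (\<exists>!f. f \<in> hom C Z X))"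

definition pointed :: "('o, 'a) category \<Rightarrow> bool" where
  "pointed C \<longleftrightarrow> (\<exists>Z. zero_object C Z)"

definition zero_map :: "('o, 'a) category \<Rightarrow> 'o \<Rightarrow> 'o \<Rightarrow> 'a" where
  "zero_map C A B =
     (THE f. \<exists>Z. zero_object C Z \<and> (\<exists>a \<in> hom C A Z. \<exists>b \<in> hom C Z B. f = b \<cdot>\<^bsub>C\<^esub> a))"

definition is_kernel :: "('o, 'a) category \<Rightarrow> 'a \<Rightarrow> 'a \<Rightarrow> bool" where
  "is_kernel C f k \<longleftrightarrow> f \<in> Arr C \<and> k \<in> hom C (Dom C k) (Dom C f) \<and>
     f \<cdot>\<^bsub>C\<^esub> k = zero_map C (Dom C k) (Cod C f) \<and>
     (\<forall>X. \<forall>h \<in> hom C X (Dom C f). f \<cdot>\<^bsub>C\<^esub> h = zero_map C X (Cod C f) \<longrightarrow>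
        (\<exists>!u. u \<in> hom C X (Dom C k) \<and> k \<cdot>\<^bsub>C\<^esub> u = h))"

definition regular_epi :: "('o, 'a) category \<Rightarrow> 'a \<Rightarrow> bool" where
  "regular_epi C e \<longleftrightarrow> (\<exists>f g. is_coequalizer C f g e)"

definition regular :: "('o, 'a) category \<Rightarrow> bool" where
  "regular C \<longleftrightarrow> finitely_complete C \<and>
     (\<forall>f p q. is_pullback C f f p q \<longrightarrow> (\<exists>e. is_coequalizer C p q e)) \<and>
     (\<forall>f g p q. is_pullback C f g p q \<and> regular_epi C f \<longrightarrow> regular_epi C q)"

text \<open>A point over \<open>X\<close> is a split epimorphism with codomain \<open>X\<close> together with a chosen section.
  Protomodularity says that every change-of-base functor between categories of points
  reflects isomorphisms; below, \<open>k\<close> is the image of the morphism of points \<open>h\<close>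
  under change of base along \<open>v\<close>.\<close>

definition point :: "('o, 'a) category \<Rightarrow> 'o \<Rightarrow> 'a \<Rightarrow> 'a \<Rightarrow> bool" where
  "point C X p s \<longleftrightarrow> p \<in> hom C (Dom C p) X \<and> s \<in> hom C X (Dom C p) \<and>
     p \<cdot>\<^bsub>C\<^esub> s = Ident C X"

definition point_morphism ::
  "('o, 'a) category \<Rightarrow> 'a \<Rightarrow> 'a \<Rightarrow> 'a \<Rightarrow> 'a \<Rightarrow> 'a \<Rightarrow> bool" where
  "point_morphism C p s p' s' h \<longleftrightarrow> h \<in> hom C (Dom C p) (Dom C p') \<and>
     p' \<cdot>\<^bsub>C\<^esub> h = p \<and> h \<cdot>\<^bsub>C\<^esub> s = s'"

definition protomodular :: "('o, 'a) category \<Rightarrow> bool" where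
  "protomodular C \<longleftrightarrow>
     (\<forall>X Y v p s p' s' h a b a' b' k.
        v \<in> hom C Y X \<and> point C X p s \<and> point C X p' s' \<and> point_morphism C p s p' s' h \<and>
        is_pullback C p v a b \<and> is_pullback C p' v a' b' \<and>
        k \<in> hom C (Dom C a) (Dom C a') \<and> a' \<cdot>\<^bsub>C\<^esub> k = h \<cdot>\<^bsub>C\<^esub> a \<and> b' \<cdot>\<^bsub>C\<^esub> k = b \<and>
        isomorphism C k \<longrightarrow>
        isomorphism C h)"

locale homological = category +
  assumes pointed: "pointed C"
    and finitely_complete: "finitely_complete C"
    and regular: "regular C"
    and protomodular: "protomodular C"


section \<open>Chosen products and coproducts\<close>

definition proj1 :: "('o, 'a) category \<Rightarrow> 'o \<Rightarrow> 'o \<Rightarrow> 'a" where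
  "proj1 C A B = fst (SOME (p, q). is_product C A B p q)"

definition proj2 :: "('o, 'a) category \<Rightarrow> 'o \<Rightarrow> 'o \<Rightarrow> 'a" where
  "proj2 C A B = snd (SOME (p, q). is_product C A B p q)"

definition prod_obj :: "('o, 'a) category \<Rightarrow> 'o \<Rightarrow> 'o \<Rightarrow> 'o" where
  "prod_obj C A B = Dom C (proj1 C A B)"

definition pair :: "('o, 'a) category \<Rightarrow> 'a \<Rightarrow> 'a \<Rightarrow> 'a" where
  "pair C f g = (THE u. u \<in> hom C (Dom C f) (prod_obj C (Cod C f) (Cod C g)) \<and>
     proj1 C (Cod C f) (Cod C g) \<cdot>\<^bsub>C\<^esub> u = f \<and> proj2 C (Cod C f) (Cod C g) \<cdot>\<^bsub>C\<^esub> u = g)"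

definition inj1 :: "('o, 'a) category \<Rightarrow> 'o \<Rightarrow> 'o \<Rightarrow> 'a" where
  "inj1 C A B = fst (SOME (i, j). is_coproduct C A B i j)"

definition inj2 :: "('o, 'a) category \<Rightarrow> 'o \<Rightarrow> 'o \<Rightarrow> 'a" where
  "inj2 C A B = snd (SOME (i, j). is_coproduct C A B i j)"

definition sum_obj :: "('o, 'a) category \<Rightarrow> 'o \<Rightarrow> 'o \<Rightarrow> 'o" where
  "sum_obj C A B = Cod C (inj1 C A B)"

definition copair :: "('o, 'a) category \<Rightarrow> 'a \<Rightarrow> 'a \<Rightarrow> 'a" where
  "copair C f g = (THE u. u \<in> hom C (sum_obj C (Dom C f) (Dom C g)) (Cod C f) \<and>
     u \<cdot>\<^bsub>C\<^esub> inj1 C (Dom C f) (Dom C g) = f \<and> u \<cdot>\<^bsub>C\<^esub> inj2 C (Dom C f) (Dom C g) = g)"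

definition sum_map :: "('o, 'a) category \<Rightarrow> 'a \<Rightarrow> 'a \<Rightarrow> 'a" where
  "sum_map C f g = copair C (inj1 C (Cod C f) (Cod C g) \<cdot>\<^bsub>C\<^esub> f) (inj2 C (Cod C f) (Cod C g) \<cdot>\<^bsub>C\<^esub> g)"

definition codiag :: "('o, 'a) category \<Rightarrow> 'o \<Rightarrow> 'a" where
  "codiag C E = copair C (Ident C E) (Ident C E)"


section \<open>The object \<open>(A|G)\<close> and actions\<close>

definition sum_to_prod :: "('o, 'a) category \<Rightarrow> 'o \<Rightarrow> 'o \<Rightarrow> 'a" where
  "sum_to_prod C A G =
     pair C (copair C (Ident C A) (zero_map C G A)) (copair C (zero_map C A G) (Ident C G))"

definition cross_incl :: "('o, 'a) category \<Rightarrow> 'o \<Rightarrow> 'o \<Rightarrow> 'a" where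
  "cross_incl C A G = (SOME k. is_kernel C (sum_to_prod C A G) k)"

definition cross_obj :: "('o, 'a) category \<Rightarrow> 'o \<Rightarrow> 'o \<Rightarrow> 'o" where
  "cross_obj C A G = Dom C (cross_incl C A G)"

definition cross_map :: "('o, 'a) category \<Rightarrow> 'a \<Rightarrow> 'a \<Rightarrow> 'a" where
  "cross_map C a g =
     (THE h. h \<in> hom C (cross_obj C (Dom C a) (Dom C g)) (cross_obj C (Cod C a) (Cod C g)) \<and>
        cross_incl C (Cod C a) (Cod C g) \<cdot>\<^bsub>C\<^esub> h
          = sum_map C a g \<cdot>\<^bsub>C\<^esub> cross_incl C (Dom C a) (Dom C g))"

definition action_quotient :: "('o, 'a) category \<Rightarrow> 'o \<Rightarrow> 'o \<Rightarrow> 'a \<Rightarrow> 'a" where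
  "action_quotient C A G \<psi> =
     (SOME q. is_coequalizer C (cross_incl C A G) (inj1 C A G \<cdot>\<^bsub>C\<^esub> \<psi>) q)"

definition action :: "('o, 'a) category \<Rightarrow> 'o \<Rightarrow> 'o \<Rightarrow> 'a \<Rightarrow> bool" where
  "action C A G \<psi> \<longleftrightarrow> \<psi> \<in> hom C (cross_obj C A G) A \<and>
     monic C (action_quotient C A G \<psi> \<cdot>\<^bsub>C\<^esub> inj1 C A G)"

definition c2 :: "('o, 'a) category \<Rightarrow> 'o \<Rightarrow> 'a" where
  "c2 C E = codiag C E \<cdot>\<^bsub>C\<^esub> cross_incl C E E"


section \<open>Proper subobjects and the conjugation action\<close>

text \<open>Subobjects are represented by monomorphisms.\<close>

definition proper_subobject :: "('o, 'a) category \<Rightarrow> 'o \<Rightarrow> 'o \<Rightarrow> 'a \<Rightarrow> bool" where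
  "proper_subobject C N E n \<longleftrightarrow> n \<in> hom C N E \<and> monic C n \<and> (\<exists>g. is_kernel C g n)"

definition is_image :: "('o, 'a) category \<Rightarrow> 'a \<Rightarrow> 'a \<Rightarrow> bool" where
  "is_image C f m \<longleftrightarrow> monic C m \<and>
     (\<exists>e \<in> hom C (Dom C f) (Dom C m). regular_epi C e \<and> m \<cdot>\<^bsub>C\<^esub> e = f)"

definition le_subobject :: "('o, 'a) category \<Rightarrow> 'a \<Rightarrow> 'a \<Rightarrow> bool" where
  "le_subobject C m m' \<longleftrightarrow> (\<exists>w \<in> hom C (Dom C m) (Dom C m'). m' \<cdot>\<^bsub>C\<^esub> w = m)"

text \<open>\<open>pair_map C n n' f\<close> says \<open>f(N) \<subseteq> N'\<close>, where \<open>f(N)\<close> is the image of \<open>f \<cdot> n\<close>;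
  images exist in regular categories and are unique as subobjects.\<close>

definition pair_map :: "('o, 'a) category \<Rightarrow> 'a \<Rightarrow> 'a \<Rightarrow> 'a \<Rightarrow> bool" where
  "pair_map C n n' f \<longleftrightarrow> f \<in> hom C (Cod C n) (Cod C n') \<and>
     (\<exists>m. is_image C (f \<cdot>\<^bsub>C\<^esub> n) m \<and> le_subobject C m n')"

definition restriction :: "('o, 'a) category \<Rightarrow> 'a \<Rightarrow> 'a \<Rightarrow> 'a \<Rightarrow> 'a" where
  "restriction C n n' f =
     (THE r. r \<in> hom C (Dom C n) (Dom C n') \<and> n' \<cdot>\<^bsub>C\<^esub> r = f \<cdot>\<^bsub>C\<^esub> n)"

definition conjugation_action :: "('o, 'a) category \<Rightarrow> 'o \<Rightarrow> 'o \<Rightarrow> 'a \<Rightarrow> 'a \<Rightarrow> bool" where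
  "conjugation_action C N E n c \<longleftrightarrow> action C N E c \<and>
     n \<cdot>\<^bsub>C\<^esub> c = c2 C E \<cdot>\<^bsub>C\<^esub> cross_map C n (Ident C E)"

end

theory Submission
  imports Defs
begin

text \<open>Let \<open>n\<close> be the kernel of \<open>g\<close>, and let \<open>h = \<langle>n, 1\<rangle> : N + E \<rightarrow> E\<close>, so that
  \<open>c\<^sub>2 (n|1) = h \<iota>\<close>. As \<open>g h = \<langle>0, g\<rangle>\<close> factors through \<open>N + E \<rightarrow> N \<times> E\<close>, it vanishes on
  \<open>(N|E)\<close>, and \<open>h \<iota>\<close> factors as \<open>n c\<close>. Then \<open>h\<close> itself coequalizes \<open>\<iota>\<close> and \<open>i\<^sub>N c\<close>, and
  \<open>h i\<^sub>N = n\<close> is monic, so the first injection followed by the coequalizer is monic as well.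
  Naturality is checked after composing with the monomorphism \<open>n'\<close>.\<close>

section \<open>Typing of arrows and the two finite diagram shapes\<close>

lemma homD:
  assumes "f \<in> hom C A B"
  shows "f \<in> Arr C" "Dom C f = A" "Cod C f = B"
  using assms by (auto simp: hom_def)

text \<open>The discrete shape, with each arrow the identity of the object of the same number. Only
  equal arrows are composable, so it makes no difference which of the two factors is
  returned.\<close>

definition two_objects :: "(nat, nat) category" where
  "two_objects = \<lparr>Obj = {0, 1}, Arr = {0, 1}, Dom = id, Cod = id, Ident = id, Comp = (\<lambda>g f. f)\<rparr>"

text \<open>The arrows 0 and 1 are the identities, and 2 and 3 are the two arrows from 0 to 1.\<close>

definition parallel_pair :: "(nat, nat) category" where
  "parallel_pair = \<lparr>Obj = {0, 1}, Arr = {0, 1, 2, 3},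
     Dom = (\<lambda>u. if u = 1 then 1 else 0), Cod = (\<lambda>u. if u = 0 then 0 else 1),
     Ident = id, Comp = (\<lambda>v u. if u \<le> 1 then v else u)\<rparr>"

lemma category_two_objects: "category two_objects"
  by unfold_locales (auto simp: two_objects_def hom_def)

text \<open>In a composable pair the inner arrow \<open>u\<close> is either an identity, so that
  \<open>u \<le> 1\<close> and the composite is \<open>v\<close>, or one of 2 and 3, after which
  \<open>v\<close> can only be the identity of 1. The operation is associative on all numbers;
  closure and the unit laws need the case split over the four arrows.\<close>

lemma category_parallel_pair: "category parallel_pair"
proof
  fix f g h and W X Y Z :: nat
  assume "f \<in> hom parallel_pair W X" "g \<in> hom parallel_pair X Y" "h \<in> hom parallel_pair Y Z"
  then show "(h \<cdot>\<^bsub>parallel_pair\<^esub> g) \<cdot>\<^bsub>parallel_pair\<^esub> f = h \<cdot>\<^bsub>parallel_pair\<^esub> (g \<cdot>\<^bsub>parallel_pair\<^esub> f)"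
    by (simp add: parallel_pair_def)
next
  fix f g and X Y Z :: nat
  assume "f \<in> hom parallel_pair X Y" "g \<in> hom parallel_pair Y Z"
  moreover from this have "f \<in> {0, 1, 2, 3}" "g \<in> {0, 1, 2, 3}"
    by (simp_all add: parallel_pair_def hom_def)
  ultimately show "g \<cdot>\<^bsub>parallel_pair\<^esub> f \<in> hom parallel_pair X Z"
    by (elim insertE) (simp_all add: parallel_pair_def hom_def)
next
  fix f and X Y :: nat
  assume "f \<in> hom parallel_pair X Y"
  moreover from this have "f \<in> {0, 1, 2, 3}"
    by (simp add: parallel_pair_def hom_def)
  ultimately show "f \<cdot>\<^bsub>parallel_pair\<^esub> Ident parallel_pair X = f"
    "Ident parallel_pair Y \<cdot>\<^bsub>parallel_pair\<^esub> f = f"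
    by (elim insertE; auto simp: parallel_pair_def hom_def)+
qed (auto simp: parallel_pair_def hom_def)

context category
begin

lemma hom_Obj:
  assumes "f \<in> hom C A B"
  shows "A \<in> Obj C" "B \<in> Obj C"
  using assms Dom_in_Obj Cod_in_Obj by (auto simp: hom_def)

section \<open>Binary products and sums, equalizers and coequalizers\<close>

lemma functor_two_objects:
  assumes "A \<in> Obj C" "B \<in> Obj C"
  shows "is_functor two_objects C (\<lambda>j. if j = 0 then A else B)
    (\<lambda>j. if j = 0 then Ident C A else Ident C B)"
  using assms Ident_in_hom[of A] Ident_in_hom[of B]
  by (auto simp: is_functor_def two_objects_def Comp_Ident_left)

lemma functor_parallel_pair:
  assumes "f \<in> hom C A B" "g \<in> hom C A B"
  shows "is_functor parallel_pair C (\<lambda>j. if j = 0 then A else B)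
    (\<lambda>u. if u = 0 then Ident C A else if u = 1 then Ident C B else if u = 2 then f else g)"
  using assms hom_Obj[OF assms(1)] Ident_in_hom[of A] Ident_in_hom[of B]
  by (auto simp: is_functor_def parallel_pair_def Comp_Ident_left Comp_Ident_right)

lemma product_exists:
  assumes "finitely_complete C" and A: "A \<in> Obj C" and B: "B \<in> Obj C"
  shows "\<exists>p q. is_product C A B p q"
proof -
  let ?Fo = "\<lambda>j. if j = (0::nat) then A else B"
  let ?Fa = "\<lambda>j. if j = (0::nat) then Ident C A else Ident C B"
  have "finite (Obj two_objects)" "finite (Arr two_objects)"
    by (simp_all add: two_objects_def)
  then obtain L p where lim: "limit_cone two_objects C ?Fo ?Fa L p"
    using assms(1) category_two_objects functor_two_objects[OF A B]
    unfolding finitely_complete_def by blast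
  \<comment> \<open>The shape has only identity arrows, so a cone is just a pair of arrows out of
    \<open>M\<close>; that \<open>M\<close> is an object follows from the type of either
    leg.\<close>
  have cone_iff: "cone two_objects C ?Fo ?Fa M q \<longleftrightarrow> q 0 \<in> hom C M A \<and> q 1 \<in> hom C M B" for M q
    using hom_Obj(1)[of "q 0" M A]
    by (auto simp: cone_def two_objects_def Comp_Ident_left)
  have p: "p 0 \<in> hom C L A" "p 1 \<in> hom C L B"
    using lim by (auto simp: limit_cone_def cone_iff)
  have "\<exists>!u. u \<in> hom C X L \<and> p 0 \<cdot> u = f \<and> p 1 \<cdot> u = g"
    if "f \<in> hom C X A" "g \<in> hom C X B" for X f g
  proof -
    have "cone two_objects C ?Fo ?Fa X (\<lambda>j. if j = 0 then f else g)"
      using that by (simp add: cone_iff)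
    then have "\<exists>!u. u \<in> hom C X L \<and> (\<forall>j \<in> Obj two_objects. p j \<cdot> u = (if j = 0 then f else g))"
      using lim unfolding limit_cone_def by blast
    then show ?thesis by (simp add: two_objects_def)
  qed
  then have "is_product C A B (p 0) (p 1)"
    using p by (auto simp: is_product_def homD(2)[OF p(1)])
  then show ?thesis by blast
qed

lemma coproduct_exists:
  assumes "finitely_cocomplete C" and A: "A \<in> Obj C" and B: "B \<in> Obj C"
  shows "\<exists>i j. is_coproduct C A B i j"
proof -
  let ?Fo = "\<lambda>j. if j = (0::nat) then A else B"
  let ?Fa = "\<lambda>j. if j = (0::nat) then Ident C A else Ident C B"
  have "finite (Obj two_objects)" "finite (Arr two_objects)"
    by (simp_all add: two_objects_def)
  then obtain L p where colim: "colimit_cocone two_objects C ?Fo ?Fa L p"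
    using assms(1) category_two_objects functor_two_objects[OF A B]
    unfolding finitely_cocomplete_def by blast
  have cocone_iff: "cocone two_objects C ?Fo ?Fa M q \<longleftrightarrow> q 0 \<in> hom C A M \<and> q 1 \<in> hom C B M" for M q
    using hom_Obj(2)[of "q 0" A M]
    by (auto simp: cocone_def two_objects_def Comp_Ident_right)
  have p: "p 0 \<in> hom C A L" "p 1 \<in> hom C B L"
    using colim by (auto simp: colimit_cocone_def cocone_iff)
  have "\<exists>!u. u \<in> hom C L X \<and> u \<cdot> p 0 = f \<and> u \<cdot> p 1 = g"
    if "f \<in> hom C A X" "g \<in> hom C B X" for X f g
  proof -
    have "cocone two_objects C ?Fo ?Fa X (\<lambda>j. if j = 0 then f else g)"
      using that by (simp add: cocone_iff)
    then have "\<exists>!u. u \<in> hom C L X \<and> (\<forall>j \<in> Obj two_objects. u \<cdot> p j = (if j = 0 then f else g))"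
      using colim unfolding colimit_cocone_def by blast
    then show ?thesis by (simp add: two_objects_def)
  qed
  then have "is_coproduct C A B (p 0) (p 1)"
    using p by (auto simp: is_coproduct_def homD(3)[OF p(1)])
  then show ?thesis by blast
qed

text \<open>Its purpose is the construction of kernels, which are equalizers of a map with a zero
  map.\<close>

lemma equalizer_exists:
  assumes "finitely_complete C" and f: "f \<in> hom C A B" and g: "g \<in> hom C A B"
  shows "\<exists>L. \<exists>k \<in> hom C L A. f \<cdot> k = g \<cdot> k \<and>
    (\<forall>X. \<forall>h \<in> hom C X A. f \<cdot> h = g \<cdot> h \<longrightarrow> (\<exists>!u. u \<in> hom C X L \<and> k \<cdot> u = h))"
proof -
  let ?Fo = "\<lambda>j. if j = (0::nat) then A else B"
  let ?Fa = "\<lambda>u. if u = (0::nat) then Ident C A else if u = 1 then Ident C B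
    else if u = 2 then f else g"
  have "finite (Obj parallel_pair)" "finite (Arr parallel_pair)"
    by (simp_all add: parallel_pair_def)
  then obtain L p where lim: "limit_cone parallel_pair C ?Fo ?Fa L p"
    using assms(1) category_parallel_pair functor_parallel_pair[OF f g]
    unfolding finitely_complete_def by blast
  \<comment> \<open>All data sit in the leg at 0: arrow 2 forces the leg at 1 to be
    \<open>f \<cdot> q 0\<close>, and arrow 3 then turns into the equalizing equation.\<close>
  have cone_iff: "cone parallel_pair C ?Fo ?Fa M q \<longleftrightarrow>
      q 0 \<in> hom C M A \<and> q 1 = f \<cdot> q 0 \<and> f \<cdot> q 0 = g \<cdot> q 0" for M q
    using hom_Obj(1)[of "q 0" M A] Comp_in_hom[OF _ f, of "q 0" M]
      Comp_Ident_left[of "f \<cdot> q 0" M B]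
    by (auto simp: cone_def parallel_pair_def Comp_Ident_left simp flip: One_nat_def)
  have p: "p 0 \<in> hom C L A" "p 1 = f \<cdot> p 0" "f \<cdot> p 0 = g \<cdot> p 0"
    using lim by (auto simp: limit_cone_def cone_iff)
  have "\<exists>!u. u \<in> hom C X L \<and> p 0 \<cdot> u = h"
    if h: "h \<in> hom C X A" and "f \<cdot> h = g \<cdot> h" for X h
  proof -
    have "cone parallel_pair C ?Fo ?Fa X (\<lambda>j. if j = 0 then h else f \<cdot> h)"
      using that by (simp add: cone_iff)
    then have "\<exists>!u. u \<in> hom C X L \<and>
        (\<forall>j \<in> Obj parallel_pair. p j \<cdot> u = (if j = 0 then h else f \<cdot> h))"
      using lim unfolding limit_cone_def by blast
    \<comment> \<open>Agreement of the legs at 0 implies agreement at 1, so the universal property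
      reduces to a single equation on \<open>u\<close>.\<close>
    moreover have "p 1 \<cdot> u = f \<cdot> h" if "u \<in> hom C X L" "p 0 \<cdot> u = h" for u
      using that p Comp_assoc[OF that(1) p(1) f] by simp
    ultimately show ?thesis by (auto simp: parallel_pair_def)
  qed
  then show ?thesis using p by blast
qed

lemma coequalizer_exists:
  assumes "finitely_cocomplete C" and f: "f \<in> hom C A B" and g: "g \<in> hom C A B"
  shows "\<exists>q. is_coequalizer C f g q"
proof -
  let ?Fo = "\<lambda>j. if j = (0::nat) then A else B"
  let ?Fa = "\<lambda>u. if u = (0::nat) then Ident C A else if u = 1 then Ident C B
    else if u = 2 then f else g"
  have "finite (Obj parallel_pair)" "finite (Arr parallel_pair)"
    by (simp_all add: parallel_pair_def)
  then obtain L p where colim: "colimit_cocone parallel_pair C ?Fo ?Fa L p"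
    using assms(1) category_parallel_pair functor_parallel_pair[OF f g]
    unfolding finitely_cocomplete_def by blast
  \<comment> \<open>Dually, the leg at 1 carries the data and the leg at 0 is forced; hence the
    coequalizer is \<open>p 1\<close>.\<close>
  have cocone_iff: "cocone parallel_pair C ?Fo ?Fa M q \<longleftrightarrow>
      q 1 \<in> hom C B M \<and> q 0 = q 1 \<cdot> f \<and> q 1 \<cdot> f = q 1 \<cdot> g" for M q
    using hom_Obj(2)[of "q 1" B M] Comp_in_hom[OF f, of "q 1" M]
    by (auto simp: cocone_def parallel_pair_def Comp_Ident_right)
  have p: "p 1 \<in> hom C B L" "p 0 = p 1 \<cdot> f" "p 1 \<cdot> f = p 1 \<cdot> g"
    using colim by (auto simp: colimit_cocone_def cocone_iff)
  have "\<exists>!u. u \<in> hom C L X \<and> u \<cdot> p 1 = h"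
    if h: "h \<in> hom C B X" and "h \<cdot> f = h \<cdot> g" for X h
  proof -
    have "cocone parallel_pair C ?Fo ?Fa X (\<lambda>j. if j = 0 then h \<cdot> f else h)"
      using that by (simp add: cocone_iff)
    then have "\<exists>!u. u \<in> hom C L X \<and>
        (\<forall>j \<in> Obj parallel_pair. u \<cdot> p j = (if j = 0 then h \<cdot> f else h))"
      using colim unfolding colimit_cocone_def by blast
    moreover have "u \<cdot> p 0 = h \<cdot> f" if "u \<in> hom C L X" "u \<cdot> p 1 = h" for u
      using that p Comp_assoc[OF f p(1) that(1)] by simp
    ultimately show ?thesis by (auto simp: parallel_pair_def)
  qed
  then have "is_coequalizer C f g (p 1)"
    using p f g by (auto simp: is_coequalizer_def homD[OF f] homD(3)[OF p(1)] simp del: One_nat_def)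
  then show ?thesis by blast
qed

section \<open>Zero maps and kernels\<close>

lemma zero_object_arrows:
  assumes "zero_object C Z" "X \<in> Obj C"
  shows "\<exists>!f. f \<in> hom C X Z" "\<exists>!f. f \<in> hom C Z X"
  using assms by (simp_all add: zero_object_def)

text \<open>The description in \<open>zero_map\<close> does not depend on the zero object: the
  comparison arrow \<open>t\<close> between two of them satisfies \<open>t \<cdot> a = a'\<close>
  and \<open>b' \<cdot> t = b\<close>, by uniqueness of arrows into \<open>Z'\<close> and out of
  \<open>Z\<close>, so both factorizations have the same composite.\<close>

lemma zero_map_eq:
  assumes Z: "zero_object C Z" and a: "a \<in> hom C A Z" and b: "b \<in> hom C Z B"
  shows "zero_map C A B = b \<cdot> a"
  unfolding zero_map_def
proof (rule the_equality)
  show "\<exists>Z. zero_object C Z \<and> (\<exists>a' \<in> hom C A Z. \<exists>b' \<in> hom C Z B. b \<cdot> a = b' \<cdot> a')"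
    using assms by blast
next
  fix f
  assume "\<exists>Z. zero_object C Z \<and> (\<exists>a \<in> hom C A Z. \<exists>b \<in> hom C Z B. f = b \<cdot> a)"
  then obtain Z' a' b' where Z': "zero_object C Z'"
    and a': "a' \<in> hom C A Z'" and b': "b' \<in> hom C Z' B" and f: "f = b' \<cdot> a'"
    by blast
  obtain t where t: "t \<in> hom C Z Z'"
    using zero_object_arrows(1)[OF Z' hom_Obj(2)[OF a]] by blast
  have "t \<cdot> a = a'"
    using zero_object_arrows(1)[OF Z' hom_Obj(1)[OF a]] Comp_in_hom[OF a t] a' by blast
  moreover have "b' \<cdot> t = b"
    using zero_object_arrows(2)[OF Z hom_Obj(2)[OF b]] Comp_in_hom[OF t b'] b by blast
  ultimately show "f = b \<cdot> a"
    using f Comp_assoc[OF a t b'] by simp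
qed

lemma zero_map_factors:
  assumes "pointed C" "A \<in> Obj C" "B \<in> Obj C"
  obtains Z a b where "zero_object C Z" "a \<in> hom C A Z" "b \<in> hom C Z B" "zero_map C A B = b \<cdot> a"
proof -
  obtain Z where Z: "zero_object C Z"
    using assms(1) unfolding pointed_def by blast
  obtain a b where "a \<in> hom C A Z" "b \<in> hom C Z B"
    using zero_object_arrows(1)[OF Z assms(2)] zero_object_arrows(2)[OF Z assms(3)] by blast
  then show thesis using that Z zero_map_eq by blast
qed

lemma zero_map_hom:
  assumes "pointed C" "A \<in> Obj C" "B \<in> Obj C"
  shows "zero_map C A B \<in> hom C A B"
  using zero_map_factors[OF assms] Comp_in_hom by metis

text \<open>A map factoring through a zero object still does so after composition with
  \<open>f\<close>, and every such factorization computes the zero map.\<close>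

lemma Comp_zero_map:
  assumes "pointed C" "A \<in> Obj C" and f: "f \<in> hom C B D"
  shows "f \<cdot> zero_map C A B = zero_map C A D"
proof -
  obtain Z a b where Z: "zero_object C Z" "a \<in> hom C A Z" "b \<in> hom C Z B" "zero_map C A B = b \<cdot> a"
    using zero_map_factors[OF assms(1,2) hom_Obj(1)[OF f]] .
  then show ?thesis
    using zero_map_eq[OF Z(1,2) Comp_in_hom[OF Z(3) f]] Comp_assoc[OF Z(2,3) f] by simp
qed

lemma zero_map_Comp:
  assumes "pointed C" "D \<in> Obj C" and f: "f \<in> hom C A B"
  shows "zero_map C B D \<cdot> f = zero_map C A D"
proof -
  obtain Z a b where Z: "zero_object C Z" "a \<in> hom C B Z" "b \<in> hom C Z D" "zero_map C B D = b \<cdot> a"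
    using zero_map_factors[OF assms(1) hom_Obj(2)[OF f] assms(2)] .
  then show ?thesis
    using zero_map_eq[OF Z(1) Comp_in_hom[OF f Z(2)] Z(3)] Comp_assoc[OF f Z(2,3)] by simp
qed

lemma kernel_exists:
  assumes "pointed C" "finitely_complete C" and f: "f \<in> hom C A B"
  shows "\<exists>k. is_kernel C f k"
proof -
  have z: "zero_map C A B \<in> hom C A B"
    using zero_map_hom[OF assms(1)] hom_Obj[OF f] by blast
  \<comment> \<open>This turns the equalizing condition for \<open>f\<close> and the zero map into
    the kernel condition.\<close>
  have zc: "zero_map C A B \<cdot> h = zero_map C X B" if "h \<in> hom C X A" for X h
    using zero_map_Comp[OF assms(1) hom_Obj(2)[OF f] that] .
  obtain L k where "k \<in> hom C L A" "f \<cdot> k = zero_map C A B \<cdot> k"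
    "\<forall>X. \<forall>h \<in> hom C X A. f \<cdot> h = zero_map C A B \<cdot> h \<longrightarrow> (\<exists>!u. u \<in> hom C X L \<and> k \<cdot> u = h)"
    using equalizer_exists[OF assms(2) f z] by blast
  then have "is_kernel C f k"
    by (simp add: is_kernel_def homD[OF f] homD(2)[OF \<open>k \<in> hom C L A\<close>] zc)
  then show ?thesis by blast
qed

lemma monic_cancel:
  assumes "monic C m" "m \<in> hom C A B" "u \<in> hom C X A" "v \<in> hom C X A" "m \<cdot> u = m \<cdot> v"
  shows "u = v"
  using assms by (auto simp: monic_def homD(2)[OF assms(2)])

text \<open>Used with \<open>w\<close> a map out of a coequalizer, to pass from a monic composite
  back to the part before \<open>w\<close>.\<close>

lemma monic_of_Comp:
  assumes m: "m \<in> hom C A B" and w: "w \<in> hom C B D" and "monic C (w \<cdot> m)"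
  shows "monic C m"
  unfolding monic_def homD(2)[OF m]
proof (intro conjI allI ballI impI)
  show "m \<in> Arr C" using homD(1)[OF m] .
  fix X u v
  assume u: "u \<in> hom C X A" and v: "v \<in> hom C X A" and eq: "m \<cdot> u = m \<cdot> v"
  show "u = v"
    using monic_cancel[OF assms(3) Comp_in_hom[OF m w] u v]
      Comp_assoc[OF u m w] Comp_assoc[OF v m w] eq by simp
qed

end

section \<open>Calculus of the chosen products and sums\<close>

locale cocomplete_homological = homological +
  assumes finitely_cocomplete: "finitely_cocomplete C"
begin

lemma is_product_proj:
  assumes "A \<in> Obj C" "B \<in> Obj C"
  shows "is_product C A B (proj1 C A B) (proj2 C A B)"
proof -
  \<comment> \<open>The choice is made under a pair pattern, so the chosen property first appears as
    a \<open>case\<close> expression.\<close>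
  have "case (SOME (p, q). is_product C A B p q) of (p, q) \<Rightarrow> is_product C A B p q"
    by (rule someI_ex) (use product_exists[OF finitely_complete assms] in auto)
  then show ?thesis
    by (simp add: proj1_def proj2_def split_beta)
qed

lemma is_coproduct_inj:
  assumes "A \<in> Obj C" "B \<in> Obj C"
  shows "is_coproduct C A B (inj1 C A B) (inj2 C A B)"
proof -
  have "case (SOME (p, q). is_coproduct C A B p q) of (p, q) \<Rightarrow> is_coproduct C A B p q"
    by (rule someI_ex) (use coproduct_exists[OF finitely_cocomplete assms] in auto)
  then show ?thesis
    by (simp add: inj1_def inj2_def split_beta)
qed

lemma proj_hom:
  assumes "A \<in> Obj C" "B \<in> Obj C"
  shows "proj1 C A B \<in> hom C (prod_obj C A B) A" "proj2 C A B \<in> hom C (prod_obj C A B) B"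
  using is_product_proj[OF assms] by (auto simp: is_product_def prod_obj_def)

lemma inj_hom:
  assumes "A \<in> Obj C" "B \<in> Obj C"
  shows "inj1 C A B \<in> hom C A (sum_obj C A B)" "inj2 C A B \<in> hom C B (sum_obj C A B)"
  using is_coproduct_inj[OF assms] by (auto simp: is_coproduct_def sum_obj_def)

text \<open>Both maps solve the universal problem posed by the components of \<open>v\<close>, and
  its solution is unique.\<close>

lemma prod_eqI:
  assumes "A \<in> Obj C" "B \<in> Obj C"
    and u: "u \<in> hom C X (prod_obj C A B)" and v: "v \<in> hom C X (prod_obj C A B)"
    and "proj1 C A B \<cdot> u = proj1 C A B \<cdot> v" "proj2 C A B \<cdot> u = proj2 C A B \<cdot> v"
  shows "u = v"
proof -
  have "\<exists>!w. w \<in> hom C X (prod_obj C A B) \<and>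
      proj1 C A B \<cdot> w = proj1 C A B \<cdot> v \<and> proj2 C A B \<cdot> w = proj2 C A B \<cdot> v"
    using is_product_proj[OF assms(1,2)] Comp_in_hom[OF v proj_hom(1)[OF assms(1,2)]]
      Comp_in_hom[OF v proj_hom(2)[OF assms(1,2)]]
    unfolding is_product_def prod_obj_def[symmetric] by blast
  then show ?thesis using assms by blast
qed

lemma sum_eqI:
  assumes "A \<in> Obj C" "B \<in> Obj C"
    and u: "u \<in> hom C (sum_obj C A B) X" and v: "v \<in> hom C (sum_obj C A B) X"
    and "u \<cdot> inj1 C A B = v \<cdot> inj1 C A B" "u \<cdot> inj2 C A B = v \<cdot> inj2 C A B"
  shows "u = v"
proof -
  have "\<exists>!w. w \<in> hom C (sum_obj C A B) X \<and>
      w \<cdot> inj1 C A B = v \<cdot> inj1 C A B \<and> w \<cdot> inj2 C A B = v \<cdot> inj2 C A B"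
    using is_coproduct_inj[OF assms(1,2)] Comp_in_hom[OF inj_hom(1)[OF assms(1,2)] v]
      Comp_in_hom[OF inj_hom(2)[OF assms(1,2)] v]
    unfolding is_coproduct_def sum_obj_def[symmetric] by blast
  then show ?thesis using assms by blast
qed

lemma pair_props:
  assumes f: "f \<in> hom C X A" and g: "g \<in> hom C X B"
  shows "pair C f g \<in> hom C X (prod_obj C A B)"
    "proj1 C A B \<cdot> pair C f g = f" "proj2 C A B \<cdot> pair C f g = g"
proof -
  have "\<exists>!u. u \<in> hom C X (prod_obj C A B) \<and> proj1 C A B \<cdot> u = f \<and> proj2 C A B \<cdot> u = g"
    using is_product_proj[OF hom_Obj(2)[OF f] hom_Obj(2)[OF g]] f g
    unfolding is_product_def prod_obj_def[symmetric] by blast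
  from theI'[OF this]
  show "pair C f g \<in> hom C X (prod_obj C A B)"
    "proj1 C A B \<cdot> pair C f g = f" "proj2 C A B \<cdot> pair C f g = g"
    by (simp_all add: pair_def homD[OF f] homD[OF g])
qed

lemma copair_props:
  assumes f: "f \<in> hom C A X" and g: "g \<in> hom C B X"
  shows "copair C f g \<in> hom C (sum_obj C A B) X"
    "copair C f g \<cdot> inj1 C A B = f" "copair C f g \<cdot> inj2 C A B = g"
proof -
  have "\<exists>!u. u \<in> hom C (sum_obj C A B) X \<and> u \<cdot> inj1 C A B = f \<and> u \<cdot> inj2 C A B = g"
    using is_coproduct_inj[OF hom_Obj(1)[OF f] hom_Obj(1)[OF g]] f g
    unfolding is_coproduct_def sum_obj_def[symmetric] by blast
  from theI'[OF this]
  show "copair C f g \<in> hom C (sum_obj C A B) X"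
    "copair C f g \<cdot> inj1 C A B = f" "copair C f g \<cdot> inj2 C A B = g"
    by (simp_all add: copair_def homD[OF f] homD[OF g])
qed

lemma Comp_copair:
  assumes f: "f \<in> hom C A X" and g: "g \<in> hom C B X" and h: "h \<in> hom C X Y"
  shows "h \<cdot> copair C f g = copair C (h \<cdot> f) (h \<cdot> g)"
proof (rule sum_eqI)
  note A = hom_Obj(1)[OF f] and B = hom_Obj(1)[OF g]
  note fg = copair_props[OF f g] and hfg = copair_props[OF Comp_in_hom[OF f h] Comp_in_hom[OF g h]]
  show "A \<in> Obj C" "B \<in> Obj C" by (fact A, fact B)
  show "h \<cdot> copair C f g \<in> hom C (sum_obj C A B) Y" using Comp_in_hom[OF fg(1) h] .
  show "copair C (h \<cdot> f) (h \<cdot> g) \<in> hom C (sum_obj C A B) Y" by (fact hfg(1))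
  show "(h \<cdot> copair C f g) \<cdot> inj1 C A B = copair C (h \<cdot> f) (h \<cdot> g) \<cdot> inj1 C A B"
    using Comp_assoc[OF inj_hom(1)[OF A B] fg(1) h] fg hfg by simp
  show "(h \<cdot> copair C f g) \<cdot> inj2 C A B = copair C (h \<cdot> f) (h \<cdot> g) \<cdot> inj2 C A B"
    using Comp_assoc[OF inj_hom(2)[OF A B] fg(1) h] fg hfg by simp
qed

lemma sum_map_hom:
  assumes f: "f \<in> hom C A A'" and g: "g \<in> hom C B B'"
  shows "sum_map C f g \<in> hom C (sum_obj C A B) (sum_obj C A' B')"
  unfolding sum_map_def homD[OF f] homD[OF g]
  by (intro copair_props Comp_in_hom[OF f] Comp_in_hom[OF g] inj_hom hom_Obj(2)[OF f] hom_Obj(2)[OF g])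

text \<open>A sum map is itself a copairing, so \<open>copair C u v\<close> can be moved inside it
  and meets the injections there.\<close>

lemma copair_sum_map:
  assumes f: "f \<in> hom C A A'" and g: "g \<in> hom C B B'"
    and u: "u \<in> hom C A' X" and v: "v \<in> hom C B' X"
  shows "copair C u v \<cdot> sum_map C f g = copair C (u \<cdot> f) (v \<cdot> g)"
proof -
  note i = inj_hom[OF hom_Obj(2)[OF f] hom_Obj(2)[OF g]]
  note uv = copair_props[OF u v]
  show ?thesis
    unfolding sum_map_def homD[OF f] homD[OF g]
    using Comp_copair[OF Comp_in_hom[OF f i(1)] Comp_in_hom[OF g i(2)] uv(1)]
      Comp_assoc[OF f i(1) uv(1)] Comp_assoc[OF g i(2) uv(1)] uv by simp
qed

lemma zero_hom: "A \<in> Obj C \<Longrightarrow> B \<in> Obj C \<Longrightarrow> zero_map C A B \<in> hom C A B"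
  using zero_map_hom[OF pointed] .

section \<open>The object \<open>(A|G)\<close> and its functoriality\<close>

lemma sum_to_prod_props:
  assumes A: "A \<in> Obj C" and G: "G \<in> Obj C"
  shows "sum_to_prod C A G \<in> hom C (sum_obj C A G) (prod_obj C A G)"
    "proj1 C A G \<cdot> sum_to_prod C A G = copair C (Ident C A) (zero_map C G A)"
    "proj2 C A G \<cdot> sum_to_prod C A G = copair C (zero_map C A G) (Ident C G)"
  using pair_props[OF copair_props(1)[OF Ident_in_hom[OF A] zero_hom[OF G A]]
      copair_props(1)[OF zero_hom[OF A G] Ident_in_hom[OF G]]]
  by (simp_all add: sum_to_prod_def)

lemma is_kernel_cross_incl:
  assumes "A \<in> Obj C" "G \<in> Obj C"
  shows "is_kernel C (sum_to_prod C A G) (cross_incl C A G)"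
  unfolding cross_incl_def
  by (rule someI_ex) (rule kernel_exists[OF pointed finitely_complete sum_to_prod_props(1)[OF assms]])

lemma cross_incl_hom:
  assumes "A \<in> Obj C" "G \<in> Obj C"
  shows "cross_incl C A G \<in> hom C (cross_obj C A G) (sum_obj C A G)"
  using is_kernel_cross_incl[OF assms] homD(2)[OF sum_to_prod_props(1)[OF assms]]
  by (simp add: is_kernel_def cross_obj_def)

text \<open>The two components of the equation saying that the canonical map from sum to product
  kills its kernel.\<close>

lemma cross_incl_zero:
  assumes A: "A \<in> Obj C" and G: "G \<in> Obj C"
  shows "copair C (Ident C A) (zero_map C G A) \<cdot> cross_incl C A G = zero_map C (cross_obj C A G) A"
    "copair C (zero_map C A G) (Ident C G) \<cdot> cross_incl C A G = zero_map C (cross_obj C A G) G"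
proof -
  note b = sum_to_prod_props[OF A G] and i = cross_incl_hom[OF A G] and p = proj_hom[OF A G]
  have z: "sum_to_prod C A G \<cdot> cross_incl C A G = zero_map C (cross_obj C A G) (prod_obj C A G)"
    using is_kernel_cross_incl[OF A G] homD(3)[OF b(1)] by (simp add: is_kernel_def cross_obj_def)
  show "copair C (Ident C A) (zero_map C G A) \<cdot> cross_incl C A G = zero_map C (cross_obj C A G) A"
    using Comp_assoc[OF i b(1) p(1)] Comp_zero_map[OF pointed hom_Obj(1)[OF i] p(1)] b z by simp
  show "copair C (zero_map C A G) (Ident C G) \<cdot> cross_incl C A G = zero_map C (cross_obj C A G) G"
    using Comp_assoc[OF i b(1) p(2)] Comp_zero_map[OF pointed hom_Obj(1)[OF i] p(2)] b z by simp
qed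

text \<open>The copairing of zero with \<open>g\<close> is \<open>g\<close> after the copairing of
  zero with the identity, and the latter already vanishes on \<open>(A|G)\<close>.\<close>

lemma copair_zero_cross_incl:
  assumes A: "A \<in> Obj C" and g: "g \<in> hom C G B"
  shows "copair C (zero_map C A B) g \<cdot> cross_incl C A G = zero_map C (cross_obj C A G) B"
proof -
  note G = hom_Obj(1)[OF g]
  note i = cross_incl_hom[OF A G]
  have "g \<cdot> copair C (zero_map C A G) (Ident C G) = copair C (zero_map C A B) g"
    using Comp_copair[OF zero_hom[OF A G] Ident_in_hom[OF G] g]
      Comp_zero_map[OF pointed A g] Comp_Ident_right[OF g] by simp
  then show ?thesis
    using Comp_assoc[OF i copair_props(1)[OF zero_hom[OF A G] Ident_in_hom[OF G]] g]
      cross_incl_zero(2)[OF A G] Comp_zero_map[OF pointed hom_Obj(1)[OF i] g] by simp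
qed

lemma copair_cross_incl_zero:
  assumes a: "a \<in> hom C A B" and G: "G \<in> Obj C"
  shows "copair C a (zero_map C G B) \<cdot> cross_incl C A G = zero_map C (cross_obj C A G) B"
proof -
  note A = hom_Obj(1)[OF a]
  note i = cross_incl_hom[OF A G]
  have "a \<cdot> copair C (Ident C A) (zero_map C G A) = copair C a (zero_map C G B)"
    using Comp_copair[OF Ident_in_hom[OF A] zero_hom[OF G A] a]
      Comp_zero_map[OF pointed G a] Comp_Ident_right[OF a] by simp
  then show ?thesis
    using Comp_assoc[OF i copair_props(1)[OF Ident_in_hom[OF A] zero_hom[OF G A]] a]
      cross_incl_zero(1)[OF A G] Comp_zero_map[OF pointed hom_Obj(1)[OF i] a] by simp
qed

text \<open>The map \<open>?h\<close> is killed by the canonical map for \<open>A'\<close> and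
  \<open>G'\<close>, so it factors uniquely through the kernel; this makes the description defining
  \<open>cross_map\<close> meaningful.\<close>

lemma cross_map_props:
  assumes a: "a \<in> hom C A A'" and g: "g \<in> hom C G G'"
  shows "cross_map C a g \<in> hom C (cross_obj C A G) (cross_obj C A' G')"
    "cross_incl C A' G' \<cdot> cross_map C a g = sum_map C a g \<cdot> cross_incl C A G"
proof -
  note A = hom_Obj(1)[OF a] and A' = hom_Obj(2)[OF a]
  note G = hom_Obj(1)[OF g] and G' = hom_Obj(2)[OF g]
  note i = cross_incl_hom[OF A G] and s = sum_map_hom[OF a g]
  note b = sum_to_prod_props[OF A' G'] and p = proj_hom[OF A' G']
  note h = Comp_in_hom[OF i s]
  note bh = Comp_in_hom[OF h b(1)]
  note K = hom_Obj(1)[OF i] and P = hom_Obj(1)[OF p(1)]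
  let ?h = "sum_map C a g \<cdot> cross_incl C A G"
  let ?z = "zero_map C (cross_obj C A G) (prod_obj C A' G')"
  have "sum_to_prod C A' G' \<cdot> ?h = ?z"
  \<comment> \<open>Vanishing is checked on each factor: there the composite becomes the copairing
    of \<open>a\<close> with zero, respectively of zero with \<open>g\<close>, restricted to
    \<open>(A|G)\<close>.\<close>
  proof (rule prod_eqI[OF A' G' bh zero_hom[OF K P]])
    have "copair C (Ident C A') (zero_map C G' A') \<cdot> sum_map C a g = copair C a (zero_map C G A')"
      using copair_sum_map[OF a g Ident_in_hom[OF A'] zero_hom[OF G' A']]
        Comp_Ident_left[OF a] zero_map_Comp[OF pointed A' g] by simp
    then have "copair C (Ident C A') (zero_map C G' A') \<cdot> ?h = zero_map C (cross_obj C A G) A'"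
      using Comp_assoc[OF i s copair_props(1)[OF Ident_in_hom[OF A'] zero_hom[OF G' A']]]
        copair_cross_incl_zero[OF a G] by simp
    then show "proj1 C A' G' \<cdot> (sum_to_prod C A' G' \<cdot> ?h) = proj1 C A' G' \<cdot> ?z"
      using Comp_assoc[OF h b(1) p(1)] b(2) Comp_zero_map[OF pointed K p(1)] by simp
    have "copair C (zero_map C A' G') (Ident C G') \<cdot> sum_map C a g = copair C (zero_map C A G') g"
      using copair_sum_map[OF a g zero_hom[OF A' G'] Ident_in_hom[OF G']]
        Comp_Ident_left[OF g] zero_map_Comp[OF pointed G' a] by simp
    then have "copair C (zero_map C A' G') (Ident C G') \<cdot> ?h = zero_map C (cross_obj C A G) G'"
      using Comp_assoc[OF i s copair_props(1)[OF zero_hom[OF A' G'] Ident_in_hom[OF G']]]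
        copair_zero_cross_incl[OF A g] by simp
    then show "proj2 C A' G' \<cdot> (sum_to_prod C A' G' \<cdot> ?h) = proj2 C A' G' \<cdot> ?z"
      using Comp_assoc[OF h b(1) p(2)] b(3) Comp_zero_map[OF pointed K p(2)] by simp
  qed
  then have "\<exists>!u. u \<in> hom C (cross_obj C A G) (cross_obj C A' G') \<and> cross_incl C A' G' \<cdot> u = ?h"
    using is_kernel_cross_incl[OF A' G'] h homD[OF b(1)]
    unfolding is_kernel_def cross_obj_def[of C A' G', symmetric] by simp
  from theI'[OF this]
  show "cross_map C a g \<in> hom C (cross_obj C A G) (cross_obj C A' G')"
    "cross_incl C A' G' \<cdot> cross_map C a g = ?h"
    by (simp_all add: cross_map_def homD[OF a] homD[OF g])
qed

section \<open>Existence of the conjugation action\<close>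

lemma c2_cross_map:
  assumes n: "n \<in> hom C N E"
  shows "c2 C E \<cdot> cross_map C n (Ident C E) = copair C n (Ident C E) \<cdot> cross_incl C N E"
proof -
  note N = hom_Obj(1)[OF n] and E = hom_Obj(2)[OF n]
  note I = Ident_in_hom[OF E]
  note m = cross_map_props[OF n I] and d = copair_props(1)[OF I I]
  have "c2 C E \<cdot> cross_map C n (Ident C E)
      = copair C (Ident C E) (Ident C E) \<cdot> (sum_map C n (Ident C E) \<cdot> cross_incl C N E)"
    using Comp_assoc[OF m(1) cross_incl_hom[OF E E] d] m(2) by (simp add: c2_def codiag_def)
  \<comment> \<open>The codiagonal after \<open>n + 1\<close> is the copairing of \<open>n\<close>
    with the identity.\<close>
  also have "\<dots> = copair C n (Ident C E) \<cdot> cross_incl C N E"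
    using Comp_assoc[OF cross_incl_hom[OF N E] sum_map_hom[OF n I] d]
      copair_sum_map[OF n I I I] Comp_Ident_left[OF n] Comp_Ident_left[OF I] by simp
  finally show ?thesis .
qed

text \<open>A criterion that needs no computation of the coequalizer: \<open>h\<close> coequalizes
  the defining pair, hence equals \<open>w \<cdot> q\<close>, and since
  \<open>w \<cdot> (q \<cdot> inj1 C A G)\<close> is monic, so is
  \<open>q \<cdot> inj1 C A G\<close>.\<close>

lemma action_if_equivariant_monic:
  assumes A: "A \<in> Obj C" and G: "G \<in> Obj C" and c: "c \<in> hom C (cross_obj C A G) A"
    and h: "h \<in> hom C (sum_obj C A G) X"
    and eq: "h \<cdot> cross_incl C A G = (h \<cdot> inj1 C A G) \<cdot> c" and mon: "monic C (h \<cdot> inj1 C A G)"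
  shows "action C A G c"
proof -
  note i = cross_incl_hom[OF A G] and j = inj_hom(1)[OF A G]
  define q where "q = action_quotient C A G c"
  have "is_coequalizer C (cross_incl C A G) (inj1 C A G \<cdot> c) q"
    unfolding q_def action_quotient_def
    by (rule someI_ex) (rule coequalizer_exists[OF finitely_cocomplete i Comp_in_hom[OF c j]])
  moreover have "h \<cdot> cross_incl C A G = h \<cdot> (inj1 C A G \<cdot> c)"
    using eq Comp_assoc[OF c j h] by simp
  ultimately obtain w where q: "q \<in> hom C (sum_obj C A G) (Cod C q)"
    and w: "w \<in> hom C (Cod C q) X" "w \<cdot> q = h"
    using h unfolding is_coequalizer_def homD[OF i] by blast
  have "monic C (q \<cdot> inj1 C A G)"
    using monic_of_Comp[OF Comp_in_hom[OF j q] w(1)] Comp_assoc[OF j q w(1)] w(2) mon by simp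
  then show ?thesis using c by (simp add: action_def q_def)
qed

lemma conjugation_action_exists:
  assumes "proper_subobject C N E n"
  shows "\<exists>c. conjugation_action C N E n c"
proof -
  obtain g where n: "n \<in> hom C N E" and mon: "monic C n" and ker: "is_kernel C g n"
    using assms unfolding proper_subobject_def by blast
  note N = hom_Obj(1)[OF n] and E = hom_Obj(2)[OF n]
  note I = Ident_in_hom[OF E]
  define h where "h = copair C n (Ident C E)"
  note h = copair_props[OF n I, folded h_def] and i = cross_incl_hom[OF N E]
  have g: "g \<in> hom C E (Cod C g)"
    using ker homD[OF n] by (auto simp: is_kernel_def hom_def)
  have gn: "g \<cdot> n = zero_map C N (Cod C g)"
    using ker homD[OF n] by (simp add: is_kernel_def)
  \<comment> \<open>Here normality enters: the first component \<open>g \<cdot> n\<close> is zero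
    because \<open>n\<close> is the kernel of \<open>g\<close>.\<close>
  have "g \<cdot> h = copair C (zero_map C N (Cod C g)) g"
    using Comp_copair[OF n I g] gn Comp_Ident_right[OF g] by (simp add: h_def)
  then have "g \<cdot> (h \<cdot> cross_incl C N E) = zero_map C (cross_obj C N E) (Cod C g)"
    using Comp_assoc[OF i h(1) g] copair_zero_cross_incl[OF N g] by simp
  then obtain c where c: "c \<in> hom C (cross_obj C N E) N" "n \<cdot> c = h \<cdot> cross_incl C N E"
    using ker Comp_in_hom[OF i h(1)] homD[OF n] homD[OF g] unfolding is_kernel_def by metis
  \<comment> \<open>The criterion applies with target \<open>E\<close>: the restriction of
    \<open>h\<close> to the first summand is \<open>n\<close>, which is monic, and the required
    equation is the one defining \<open>c\<close>.\<close>
  have "action C N E c"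
    by (rule action_if_equivariant_monic[OF N E c(1) h(1)]) (simp_all add: h c mon)
  moreover have "n \<cdot> c = c2 C E \<cdot> cross_map C n (Ident C E)"
    using c(2) c2_cross_map[OF n] by (simp add: h_def)
  ultimately show ?thesis by (auto simp: conjugation_action_def)
qed

section \<open>Restrictions of pair maps and naturality\<close>

lemma restriction_props:
  assumes n: "n \<in> hom C N E" and n': "n' \<in> hom C N' E'" and mon: "monic C n'"
    and "pair_map C n n' f"
  shows "restriction C n n' f \<in> hom C N N'" "n' \<cdot> restriction C n n' f = f \<cdot> n"
proof -
  obtain m e w where f: "f \<in> hom C E E'" and e: "e \<in> hom C (Dom C (f \<cdot> n)) (Dom C m)"
    and me: "m \<cdot> e = f \<cdot> n" and w: "w \<in> hom C (Dom C m) N'" and nw: "n' \<cdot> w = m"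
    using assms(4) homD[OF n] homD[OF n']
    unfolding pair_map_def is_image_def le_subobject_def by auto
  have e': "e \<in> hom C N (Dom C m)"
    using e homD(2)[OF Comp_in_hom[OF n f]] by simp
  \<comment> \<open>The restriction is the regular epimorphism \<open>e\<close> onto the image
    followed by the inclusion \<open>w\<close> of the image in \<open>N'\<close>; it is unique since
    \<open>n'\<close> is monic.\<close>
  have "w \<cdot> e \<in> hom C N N'" "n' \<cdot> (w \<cdot> e) = f \<cdot> n"
    using Comp_in_hom[OF e' w] Comp_assoc[OF e' w n'] nw me by simp_all
  then have "\<exists>!r. r \<in> hom C N N' \<and> n' \<cdot> r = f \<cdot> n"
    using monic_cancel[OF mon n'] by (intro ex1I[of _ "w \<cdot> e"]) auto
  from theI'[OF this]
  show "restriction C n n' f \<in> hom C N N'" "n' \<cdot> restriction C n n' f = f \<cdot> n"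
    by (simp_all add: restriction_def homD[OF n] homD[OF n'])
qed

text \<open>After composition with \<open>n'\<close>, both sides become the copairing of
  \<open>f \<cdot> n\<close> with \<open>f\<close>, restricted to \<open>(N|E)\<close>.\<close>

lemma conjugation_action_natural:
  assumes "proper_subobject C N E n" "proper_subobject C N' E' n'"
    and "conjugation_action C N E n c" "conjugation_action C N' E' n' c'"
    and pm: "pair_map C n n' f"
  shows "restriction C n n' f \<cdot> c = c' \<cdot> cross_map C (restriction C n n' f) f"
proof -
  have n: "n \<in> hom C N E" and n': "n' \<in> hom C N' E'" and mon: "monic C n'"
    using assms(1,2) by (auto simp: proper_subobject_def)
  have f: "f \<in> hom C E E'"
    using pm homD[OF n] homD[OF n'] by (simp add: pair_map_def)
  have c: "c \<in> hom C (cross_obj C N E) N" and c': "c' \<in> hom C (cross_obj C N' E') N'"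
    and nc: "n \<cdot> c = copair C n (Ident C E) \<cdot> cross_incl C N E"
    and nc': "n' \<cdot> c' = copair C n' (Ident C E') \<cdot> cross_incl C N' E'"
    using assms(3,4) c2_cross_map[OF n] c2_cross_map[OF n']
    by (simp_all add: conjugation_action_def action_def)
  define r where "r = restriction C n n' f"
  note r = restriction_props[OF n n' mon pm, folded r_def]
  note I = Ident_in_hom[OF hom_Obj(2)[OF n]] and I' = Ident_in_hom[OF hom_Obj(2)[OF n']]
  note i = cross_incl_hom[OF hom_Obj[OF n]] and i' = cross_incl_hom[OF hom_Obj[OF n']]
  note h = copair_props(1)[OF n I] and h' = copair_props(1)[OF n' I']
  note m = cross_map_props[OF r(1) f]
  have "n' \<cdot> (r \<cdot> c) = f \<cdot> (n \<cdot> c)"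
    using Comp_assoc[OF c r(1) n'] Comp_assoc[OF c n f] r(2) by simp
  also have "\<dots> = copair C (f \<cdot> n) f \<cdot> cross_incl C N E"
    using nc Comp_assoc[OF i h f] Comp_copair[OF n I f] Comp_Ident_right[OF f] by simp
  \<comment> \<open>Since \<open>f \<cdot> n = n' \<cdot> r\<close>, the same copairing also factors
    through \<open>r + f\<close>; the defining property of \<open>(r|f)\<close> then brings in
    \<open>c'\<close>.\<close>
  also have "\<dots> = copair C n' (Ident C E') \<cdot> (sum_map C r f \<cdot> cross_incl C N E)"
    using Comp_assoc[OF i sum_map_hom[OF r(1) f] h'] copair_sum_map[OF r(1) f n' I']
      r(2) Comp_Ident_left[OF f] by simp
  also have "\<dots> = n' \<cdot> (c' \<cdot> cross_map C r f)"
    using Comp_assoc[OF m(1) i' h'] Comp_assoc[OF m(1) c' n'] m(2) nc' by simp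
  finally show ?thesis
    using monic_cancel[OF mon n' Comp_in_hom[OF c r(1)] Comp_in_hom[OF m(1) c']]
    by (simp add: r_def)
qed

end

text \<open>Letting \<open>c'\<close> range over all conjugation actions leaves no ambiguity:
  \<open>n'\<close> is monic, so the equation for \<open>n' \<cdot> c'\<close> determines
  \<open>c'\<close>.\<close>

theorem proposition16:
  fixes C :: "('o, 'a) category" (structure)
    and N E :: 'o and n :: 'a
  assumes "homological C"
    and "finitely_cocomplete C"
    and "proper_subobject C N E n"
  shows "\<exists>c. conjugation_action C N E n c \<and>
    (\<forall>N' E' n' c' f.
       proper_subobject C N' E' n' \<and> conjugation_action C N' E' n' c' \<and> pair_map C n n' f \<longrightarrow>
       restriction C n n' f \<cdot> c = c' \<cdot> cross_map C (restriction C n n' f) f)"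
proof -
  interpret cocomplete_homological C
    using assms(1,2) by (intro cocomplete_homological.intro cocomplete_homological_axioms.intro)
  obtain c where "conjugation_action C N E n c"
    using conjugation_action_exists[OF assms(3)] by blast
  then show ?thesis
    using conjugation_action_natural[OF assms(3)] by blast
qed

end
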